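(* Let $a>0$, $\beta\in\mathbb{R}$ and $\kappa_1,\kappa_2>0$. For $i=1,2$ let $u_i$ be a solution of the boundary value problem $$\frac{u_i''(r)}{(1-u_i'(r)^2)^{3/2}}=\kappa_i\,u_i(r),\quad -a<r<a,\qquad u_i'(\pm a)=\pm\tanh\beta,$$ with $|u_i'|<1$ and $u_i(0)>0$. If $\kappa_1<\kappa_2$, then: 1. $u_1(r)>u_2(r)$ for $0\le r\le a$; 2. $u_1'(r)>u_2'(r)$ for $0<r<a$.
   Context: The same $a$ and the same $\beta$ are used in both boundary value problems. Solutions are taken up to the boundary, i.e. $u_i$ and $u_i'$ are continuous on $[-a,a]$. *)

theory Defs
  imports Complex_Main
begin

text \<open>
  Here \<open>u'\<close> is the derivative of \<open>u\<close> on the closed interval \<open>[-a, a]\<close> (one-sided at the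
  endpoints), so it is determined there by \<open>u\<close>; the values of \<open>u\<close> and \<open>u'\<close> outside
  \<open>[-a, a]\<close> are irrelevant. Continuity of \<open>u\<close> on \<open>[-a, a]\<close> is implied by differentiability.
  The second derivative is only required in the open interval.
\<close>

definition bvp_solution ::
  "real \<Rightarrow> real \<Rightarrow> real \<Rightarrow> (real \<Rightarrow> real) \<Rightarrow> (real \<Rightarrow> real) \<Rightarrow> bool" where
  "bvp_solution a \<beta> \<kappa> u u' \<longleftrightarrow>
     (\<forall>r\<in>{-a..a}. (u has_real_derivative u' r) (at r within {-a..a})) \<and>
     continuous_on {-a..a} u' \<and>
     (\<forall>r\<in>{-a<..<a}. \<bar>u' r\<bar> < 1) \<and>
     (\<forall>r\<in>{-a<..<a}. \<exists>u''. (u' has_real_derivative u'') (at r) \<and>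
        u'' / (1 - (u' r)\<^sup>2) powr (3/2) = \<kappa> * u r) \<and>
     u' (-a) = - tanh \<beta> \<and> u' a = tanh \<beta>"

end

theory Submission
  imports Defs
begin

text \<open>
  The equation is in divergence form: with \<open>p / sqrt (1 - p\<^sup>2)\<close> abbreviated by \<open>flux p\<close>, it
  says that \<open>w = flux \<circ> u'\<close> satisfies \<open>w' = \<kappa> u\<close>. Since \<open>flux\<close> is strictly increasing,
  inequalities between slopes are the same as inequalities between fluxes, and fluxes can be
  differentiated twice: \<open>w'' = \<kappa> u'\<close>.

  First, \<open>u'(0) = 0\<close> (\<open>bvp_solution_slope_zero\<close>). This is the uniqueness argument for the Neumann
  problem, applied to \<open>u\<close> and its reflection: the product of the difference of the fluxes and the
  difference of the functions is nondecreasing and vanishes at both endpoints, hence is constant. Next, from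
  \<open>u(0) > 0\<close> it follows that \<open>u' > 0\<close> on \<open>(0, a)\<close> (\<open>bvp_solution_slope_pos\<close>), because \<open>w u\<close>
  is nondecreasing from the value \<open>0\<close>, hence so is \<open>u\<^sup>2\<close>, and \<open>u\<close> keeps its sign.

  The slopes are compared first, by a maximum principle for \<open>W = w\<^sub>1 - w\<^sub>2\<close>, which vanishes at
  \<open>0\<close> and at \<open>a\<close>. If \<open>W\<close> were not positive on \<open>(0, a)\<close>, it would have a minimum there with a
  value \<open>\<le> 0\<close>. At that point \<open>u\<^sub>1' \<le> u\<^sub>2'\<close>, so
  \<open>W'' = \<kappa>\<^sub>1 u\<^sub>1' - \<kappa>\<^sub>2 u\<^sub>2' \<le> (\<kappa>\<^sub>1 - \<kappa>\<^sub>2) u\<^sub>2' < 0\<close>, which is impossible at a minimum.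
  Hence \<open>u\<^sub>1' > u\<^sub>2'\<close> on \<open>(0, a)\<close>. The heights follow: \<open>W > 0 = W(0)\<close> forces
  \<open>0 \<le> W'(0) = \<kappa>\<^sub>1 u\<^sub>1(0) - \<kappa>\<^sub>2 u\<^sub>2(0)\<close>, so \<open>u\<^sub>1(0) > u\<^sub>2(0)\<close>, and \<open>u\<^sub>1 - u\<^sub>2\<close> increases.
\<close>

section \<open>The flux\<close>

definition flux :: "real \<Rightarrow> real" where
  "flux p = p / sqrt (1 - p\<^sup>2)"

lemma one_minus_square_pos:
  fixes p :: real
  assumes "\<bar>p\<bar> < 1"
  shows "0 < 1 - p\<^sup>2"
  using assms abs_square_less_1 [of p] by simp

lemma flux_zero [simp]: "flux 0 = 0"
  by (simp add: flux_def)

lemma flux_minus [simp]: "flux (- p) = - flux p"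
  by (simp add: flux_def)

lemma has_derivative_flux:
  assumes "\<bar>p\<bar> < 1"
  shows "(flux has_real_derivative 1 / (1 - p\<^sup>2) powr (3/2)) (at p)"
proof -
  define q where "q = 1 - p\<^sup>2"
  define s where "s = sqrt q"
  have q: "0 < q" using one_minus_square_pos [OF assms] by (simp add: q_def)
  have s: "0 < s" and ss: "s * s = q" using q by (simp_all add: s_def)
  have "q powr (3/2) = q powr (1 + 1/2)" by simp
  also have "\<dots> = q * s"
    using q by (subst powr_add) (simp add: powr_half_sqrt s_def)
  finally have powr: "q powr (3/2) = q * s" .
  have "((\<lambda>p. p / sqrt (1 - p\<^sup>2)) has_real_derivative
          (1 * s - p * (- (2 * p) * (inverse s / 2))) / (s * s)) (at p)"
    unfolding s_def q_def
    by (rule derivative_eq_intros refl | use q in \<open>simp add: q_def\<close>)+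
  moreover have "(1 * s - p * (- (2 * p) * (inverse s / 2))) / (s * s) = 1 / (q * s)"
  proof -
    have "1 * s - p * (- (2 * p) * (inverse s / 2)) = (s * s + p\<^sup>2) / s"
      using s by (simp add: field_simps power2_eq_square)
    also have "\<dots> = 1 / s" by (simp add: ss q_def)
    finally show ?thesis using s ss by (simp add: field_simps)
  qed
  ultimately show ?thesis
    using powr by (simp add: q_def flux_def [abs_def])
qed

lemma flux_strict_mono:
  assumes "\<bar>x\<bar> < 1" "\<bar>y\<bar> < 1" "x < y"
  shows "flux x < flux y"
proof (rule DERIV_pos_imp_increasing [OF \<open>x < y\<close>])
  fix p assume "x \<le> p" "p \<le> y"
  then have p: "\<bar>p\<bar> < 1" using assms by linarith
  show "\<exists>d. DERIV flux p :> d \<and> 0 < d"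
    using has_derivative_flux [OF p] one_minus_square_pos [OF p] by force
qed

lemma flux_less_iff:
  assumes "\<bar>x\<bar> < 1" "\<bar>y\<bar> < 1"
  shows "flux x < flux y \<longleftrightarrow> x < y"
  by (metis assms flux_strict_mono less_asym linorder_less_linear)

lemma flux_pos_iff: "\<bar>p\<bar> < 1 \<Longrightarrow> 0 < flux p \<longleftrightarrow> 0 < p"
  using flux_less_iff [of 0 p] by simp

lemma flux_mult_nonneg: "\<bar>p\<bar> < 1 \<Longrightarrow> 0 \<le> flux p * p"
  using one_minus_square_pos [of p] by (simp add: flux_def)

lemma flux_diff_mult_diff_nonneg:
  assumes "\<bar>x\<bar> < 1" "\<bar>y\<bar> < 1"
  shows "0 \<le> (flux x - flux y) * (x - y)"
  using flux_strict_mono [of x y] flux_strict_mono [of y x] assms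
  by (cases x y rule: linorder_cases) (auto simp: mult_nonneg_nonneg mult_nonpos_nonpos)

section \<open>A single solution\<close>

lemma bvp_solution_slope_bound:
  assumes "bvp_solution a \<beta> \<kappa> u u'" "r \<in> {-a..a}"
  shows "\<bar>u' r\<bar> < 1"
proof (cases "r \<in> {-a<..<a}")
  case True
  then show ?thesis using assms by (auto simp: bvp_solution_def)
next
  case False
  then have "r = - a \<or> r = a" using assms(2) by auto
  then show ?thesis
    using assms(1) tanh_real_bounds [of \<beta>] by (auto simp: bvp_solution_def)
qed

lemma bvp_solution_continuous:
  assumes "bvp_solution a \<beta> \<kappa> u u'"
  shows "continuous_on {-a..a} u"
  using assms by (intro DERIV_continuous_on [of _ _ u']) (auto simp: bvp_solution_def)

lemma bvp_solution_deriv: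
  assumes "bvp_solution a \<beta> \<kappa> u u'" "r \<in> {-a<..<a}"
  shows "(u has_real_derivative u' r) (at r)"
proof -
  have "(u has_real_derivative u' r) (at r within {-a..a})"
    using assms by (auto simp: bvp_solution_def)
  then show ?thesis using assms(2) by (simp add: at_within_Icc_at)
qed

lemma bvp_solution_flux_continuous:
  assumes "bvp_solution a \<beta> \<kappa> u u'"
  shows "continuous_on {-a..a} (\<lambda>r. flux (u' r))"
proof (rule continuous_on_compose2 [of "{-1<..<1}" flux])
  show "continuous_on {-1<..<1} flux"
    by (intro continuous_at_imp_continuous_on ballI DERIV_isCont [OF has_derivative_flux]) auto
  show "continuous_on {-a..a} u'" using assms by (simp add: bvp_solution_def)
  show "u' ` {-a..a} \<subseteq> {-1<..<1}"
    using bvp_solution_slope_bound [OF assms] by (force simp: abs_less_iff)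
qed

lemma bvp_solution_flux_deriv:
  assumes "bvp_solution a \<beta> \<kappa> u u'" "r \<in> {-a<..<a}"
  shows "((\<lambda>r. flux (u' r)) has_real_derivative \<kappa> * u r) (at r)"
proof -
  from assms obtain u'' where
    u'': "(u' has_real_derivative u'') (at r)" "u'' / (1 - (u' r)\<^sup>2) powr (3/2) = \<kappa> * u r"
    unfolding bvp_solution_def by blast
  have "\<bar>u' r\<bar> < 1" using assms by (auto simp: bvp_solution_def)
  from DERIV_chain2 [OF has_derivative_flux [OF this] u''(1)] u''(2) show ?thesis by simp
qed

text \<open>
  The product \<open>(w(r) + w(-r)) (u(r) - u(-r))\<close> is the one from the uniqueness proof, with the second
  solution \<open>r \<mapsto> u(-r)\<close>, whose flux is \<open>-w(-r)\<close>. It is nondecreasing and vanishes at \<open>\<plusminus>a\<close>, hence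
  everywhere; its derivative at \<open>0\<close> is \<open>4 w(0) u'(0)\<close>.
\<close>

lemma bvp_solution_slope_zero:
  assumes sol: "bvp_solution a \<beta> \<kappa> u u'" and "0 < a" "0 < \<kappa>"
  shows "u' 0 = 0"
proof -
  define w where "w = (\<lambda>r. flux (u' r))"
  define G where "G = (\<lambda>r. (w r + w (- r)) * (u r - u (- r)))"
  define G' where "G' = (\<lambda>r. (\<kappa> * u r - \<kappa> * u (- r)) * (u r - u (- r)) +
                             (u' r + u' (- r)) * (w r + w (- r)))"
  have deriv: "(G has_real_derivative G' r) (at r)" if r: "r \<in> {-a<..<a}" for r
  proof -
    have m: "- r \<in> {-a<..<a}" using r by auto
    have refl_deriv: "((\<lambda>r. f (- r)) has_real_derivative - d) (at r)"
      if "(f has_real_derivative d) (at (- r))" for f d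
      using DERIV_chain2 [where f = f and g = uminus and x = r and s = UNIV, OF that
          DERIV_minus [OF DERIV_ident]]
      by (simp only: mult_minus1_right)
    have wd: "((\<lambda>r. w r + w (- r)) has_real_derivative \<kappa> * u r - \<kappa> * u (- r)) (at r)"
      using DERIV_add [OF bvp_solution_flux_deriv [OF sol r]
          refl_deriv [OF bvp_solution_flux_deriv [OF sol m]]] by (simp add: w_def)
    have ud: "((\<lambda>r. u r - u (- r)) has_real_derivative u' r + u' (- r)) (at r)"
      using DERIV_diff [OF bvp_solution_deriv [OF sol r]
          refl_deriv [OF bvp_solution_deriv [OF sol m]]] by simp
    show ?thesis unfolding G_def G'_def by (rule DERIV_mult [OF wd ud])
  qed
  have G'_nonneg: "0 \<le> G' r" if r: "r \<in> {-a<..<a}" for r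
  proof -
    have "\<bar>u' r\<bar> < 1" "\<bar>- u' (- r)\<bar> < 1" using r bvp_solution_slope_bound [OF sol] by auto
    from flux_diff_mult_diff_nonneg [OF this]
    have "0 \<le> (u' r + u' (- r)) * (w r + w (- r))" by (simp add: w_def mult.commute)
    moreover have "0 \<le> \<kappa> * (u r - u (- r))\<^sup>2" using \<open>0 < \<kappa>\<close> by simp
    ultimately show ?thesis by (simp add: G'_def algebra_simps power2_eq_square)
  qed
  have reflect_cont: "continuous_on {-a..a} (\<lambda>r. f (- r))"
    if "continuous_on {-a..a} f" for f :: "real \<Rightarrow> real"
    by (rule continuous_on_compose2 [OF that]) (auto intro: continuous_on_minus continuous_on_id)
  have w_cont: "continuous_on {-a..a} w"
    using bvp_solution_flux_continuous [OF sol] by (simp add: w_def)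
  have u_cont: "continuous_on {-a..a} u"
    by (rule bvp_solution_continuous [OF sol])
  have cont: "continuous_on {-a..a} G"
    unfolding G_def
    by (rule continuous_on_mult [OF continuous_on_add [OF w_cont reflect_cont [OF w_cont]]
          continuous_on_diff [OF u_cont reflect_cont [OF u_cont]]])
  have mono: "G x \<le> G y" if "-a \<le> x" "x \<le> y" "y \<le> a" for x y
  proof (rule DERIV_nonneg_imp_increasing_open [OF \<open>x \<le> y\<close>])
    show "\<exists>d. DERIV G r :> d \<and> 0 \<le> d" if "x < r" "r < y" for r
      using deriv [of r] G'_nonneg [of r] that \<open>-a \<le> x\<close> \<open>y \<le> a\<close> by auto
    show "continuous_on {x..y} G"
      using cont by (rule continuous_on_subset) (use that in auto)
  qed
  have ends: "G a = 0" "G (- a) = 0"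
    using sol by (simp_all add: G_def w_def bvp_solution_def)
  have zero: "G r = 0" if "r \<in> {-a<..<a}" for r
    using mono [of "-a" r] mono [of r a] ends that by auto
  have "(G has_real_derivative 0) (at 0)"
    by (rule has_field_derivative_transform_within_open
        [of "\<lambda>_. 0" _ _ "{-a<..<a}"]) (use zero \<open>0 < a\<close> in auto)
  then have "G' 0 = 0" using deriv [of 0] \<open>0 < a\<close> by (auto intro: DERIV_unique)
  then have "u' 0 = 0 \<or> flux (u' 0) = 0" by (simp add: G'_def w_def)
  moreover have "\<bar>u' 0\<bar> < 1" using bvp_solution_slope_bound [OF sol] \<open>0 < a\<close> by simp
  ultimately show ?thesis
    using one_minus_square_pos [of "u' 0"] by (auto simp: flux_def)
qed

text \<open>
  Working with \<open>w u\<close> and \<open>u\<^sup>2\<close> instead of \<open>u\<close> avoids a first-zero argument: both are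
  nondecreasing on \<open>[0, a)\<close> whatever the sign of \<open>u\<close> is, so \<open>u\<close> stays away from \<open>0\<close>.
\<close>

lemma bvp_solution_pos:
  assumes sol: "bvp_solution a \<beta> \<kappa> u u'" and "0 < a" "0 < \<kappa>" "0 < u 0"
    and r: "0 \<le> r" "r < a"
  shows "0 < u r"
proof -
  define w where "w = (\<lambda>r. flux (u' r))"
  have w_u_nonneg: "0 \<le> w x * u x" if x: "0 \<le> x" "x < a" for x
  proof -
    have "w 0 * u 0 \<le> w x * u x"
    proof (rule DERIV_nonneg_imp_nondecreasing [OF x(1)])
      fix t assume "0 \<le> t" "t \<le> x"
      then have t: "t \<in> {-a<..<a}" using x by auto
      have "((\<lambda>r. w r * u r) has_real_derivative \<kappa> * u t * u t + u' t * w t) (at t)"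
        unfolding w_def
        by (rule DERIV_mult [OF bvp_solution_flux_deriv [OF sol t] bvp_solution_deriv [OF sol t]])
      moreover have "0 \<le> \<kappa> * u t * u t" using \<open>0 < \<kappa>\<close> by (simp add: mult.assoc)
      moreover have "0 \<le> u' t * w t"
        using flux_mult_nonneg [of "u' t"] bvp_solution_slope_bound [OF sol] t
        by (simp add: w_def mult.commute)
      ultimately show "\<exists>d. DERIV (\<lambda>r. w r * u r) t :> d \<and> 0 \<le> d"
        by (meson add_nonneg_nonneg)
    qed
    moreover have "w 0 = 0"
      using bvp_solution_slope_zero [OF sol] \<open>0 < a\<close> \<open>0 < \<kappa>\<close> by (simp add: w_def)
    ultimately show ?thesis by simp
  qed
  have nonzero: "u x \<noteq> 0" if x: "0 \<le> x" "x < a" for x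
  proof -
    have "u 0 * u 0 \<le> u x * u x"
    proof (rule DERIV_nonneg_imp_nondecreasing [OF x(1)])
      fix t assume t0: "0 \<le> t" "t \<le> x"
      then have t: "t \<in> {-a<..<a}" using x by auto
      have "((\<lambda>r. u r * u r) has_real_derivative u' t * u t + u' t * u t) (at t)"
        by (rule DERIV_mult [OF bvp_solution_deriv [OF sol t] bvp_solution_deriv [OF sol t]])
      moreover have "0 \<le> u' t * u t"
      proof -
        have "0 < 1 - (u' t)\<^sup>2"
          using one_minus_square_pos bvp_solution_slope_bound [OF sol] t by simp
        then show ?thesis
          using w_u_nonneg [of t] t0 x by (simp add: w_def flux_def zero_le_divide_iff)
      qed
      ultimately show "\<exists>d. DERIV (\<lambda>r. u r * u r) t :> d \<and> 0 \<le> d"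
        by (meson add_nonneg_nonneg)
    qed
    moreover have "0 < u 0 * u 0" using \<open>0 < u 0\<close> by simp
    ultimately show ?thesis by auto
  qed
  show ?thesis
  proof (rule ccontr)
    assume "\<not> 0 < u r"
    then have "\<exists>x. 0 \<le> x \<and> x \<le> r \<and> u x = 0"
      using r \<open>0 < u 0\<close> continuous_on_subset [OF bvp_solution_continuous [OF sol], of "{0..r}"]
      by (intro IVT2') auto
    then show False using nonzero r by auto
  qed
qed

lemma bvp_solution_slope_pos:
  assumes sol: "bvp_solution a \<beta> \<kappa> u u'" and "0 < a" "0 < \<kappa>" "0 < u 0"
    and r: "0 < r" "r < a"
  shows "0 < u' r"
proof -
  have "flux (u' 0) < flux (u' r)"
  proof (rule DERIV_pos_imp_increasing [OF r(1)])
    fix t assume t: "0 \<le> t" "t \<le> r"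
    then have "0 < \<kappa> * u t"
      using bvp_solution_pos [OF assms(1-4), of t] r \<open>0 < \<kappa>\<close> by simp
    moreover have "t \<in> {-a<..<a}" using t r by auto
    ultimately show "\<exists>d. DERIV (\<lambda>r. flux (u' r)) t :> d \<and> 0 < d"
      using bvp_solution_flux_deriv [OF sol] by blast
  qed
  then show ?thesis
    using bvp_solution_slope_zero [OF assms(1-3)] bvp_solution_slope_bound [OF sol] r
    by (simp add: flux_pos_iff)
qed

section \<open>Comparison\<close>

lemma second_derivative_test_not_min:
  fixes g g' :: "real \<Rightarrow> real"
  assumes x: "l < x" "x < b"
    and deriv: "\<And>t. \<lbrakk>l < t; t < b\<rbrakk> \<Longrightarrow> (g has_real_derivative g' t) (at t)"
    and "g' x = 0" and "(g' has_real_derivative c) (at x)" and "c < 0"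
  obtains y where "l < y" "y < b" "g y < g x"
proof -
  from DERIV_neg_dec_right [OF assms(5,6)] obtain d
    where d: "0 < d" "\<And>h. \<lbrakk>0 < h; h < d\<rbrakk> \<Longrightarrow> g' (x + h) < 0"
    using \<open>g' x = 0\<close> by auto
  define y where "y = x + min d (b - x) / 2"
  have y: "x < y" "y < x + d" "y < b" using d(1) x by (auto simp: y_def min_def field_simps)
  from y x have "\<exists>z>x. z < y \<and> g y - g x = (y - x) * g' z"
    by (intro MVT2 deriv) auto
  then obtain z where z: "x < z" "z < y" "g y - g x = (y - x) * g' z" by blast
  have "g' z < 0" using d(2) [of "z - x"] z y by simp
  then have "(y - x) * g' z < 0" using y by (simp add: mult_pos_neg)
  then have "g y < g x" using z(3) by simp
  then show thesis using that [of y] y x by auto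
qed

theorem theorem4p5:
  fixes a \<beta> \<kappa>1 \<kappa>2 :: real and u1 u1' u2 u2' :: "real \<Rightarrow> real"
  assumes "a > 0" and "\<kappa>1 > 0" and "\<kappa>2 > 0"
    and "bvp_solution a \<beta> \<kappa>1 u1 u1'" and "u1 0 > 0"
    and "bvp_solution a \<beta> \<kappa>2 u2 u2'" and "u2 0 > 0"
    and "\<kappa>1 < \<kappa>2"
  shows "(\<forall>r. 0 \<le> r \<and> r \<le> a \<longrightarrow> u1 r > u2 r) \<and>
         (\<forall>r. 0 < r \<and> r < a \<longrightarrow> u1' r > u2' r)"
proof -
  note sol1 = assms(4) and sol2 = assms(6)
  define W where "W = (\<lambda>r. flux (u1' r) - flux (u2' r))"
  define W' where "W' = (\<lambda>r. \<kappa>1 * u1 r - \<kappa>2 * u2 r)"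
  have W_deriv: "(W has_real_derivative W' r) (at r)" if "r \<in> {-a<..<a}" for r
    unfolding W_def W'_def
    using that by (intro DERIV_diff bvp_solution_flux_deriv [OF sol1] bvp_solution_flux_deriv [OF sol2])
  have W'_deriv: "(W' has_real_derivative \<kappa>1 * u1' r - \<kappa>2 * u2' r) (at r)"
    if "r \<in> {-a<..<a}" for r
    unfolding W'_def
    using that by (intro DERIV_diff DERIV_cmult bvp_solution_deriv [OF sol1] bvp_solution_deriv [OF sol2])
  have W_cont: "continuous_on {0..a} W"
    unfolding W_def
    by (intro continuous_on_diff continuous_on_subset [OF bvp_solution_flux_continuous [OF sol1]]
        continuous_on_subset [OF bvp_solution_flux_continuous [OF sol2]]) auto
  have W_ends: "W 0 = 0" "W a = 0"
    using bvp_solution_slope_zero [OF sol1] bvp_solution_slope_zero [OF sol2] assms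
    by (simp_all add: W_def bvp_solution_def)

  have W_pos: "0 < W r" if r: "0 < r" "r < a" for r
  proof (rule ccontr)
    assume "\<not> 0 < W r"
    then have Wr: "W r \<le> 0" by simp
    have "\<exists>x\<in>{0..a}. \<forall>y\<in>{0..a}. W x \<le> W y"
      using W_cont \<open>a > 0\<close> by (intro continuous_attains_inf) auto
    then obtain m where m: "m \<in> {0..a}" "\<And>y. y \<in> {0..a} \<Longrightarrow> W m \<le> W y" by blast
    \<comment> \<open>If the minimum is attained at an endpoint, it is \<open>0\<close>, and \<open>r\<close> is another minimizer.\<close>
    define x where "x = (if m \<in> {0<..<a} then m else r)"
    have x: "0 < x" "x < a" using r by (auto simp: x_def)
    have x_min: "W x \<le> W y" if "y \<in> {0..a}" for y
    proof (cases "m \<in> {0<..<a}")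
      case True
      then show ?thesis using m(2) that by (simp add: x_def)
    next
      case False
      then have "m = 0 \<or> m = a" using m(1) by auto
      then show ?thesis using m(2) [OF that] W_ends Wr False by (auto simp: x_def)
    qed
    have "W x \<le> 0" using x_min [of r] Wr r by simp
    moreover have "\<bar>u1' x\<bar> < 1" "\<bar>u2' x\<bar> < 1"
      using bvp_solution_slope_bound [OF sol1] bvp_solution_slope_bound [OF sol2] x by auto
    ultimately have slopes: "u1' x \<le> u2' x"
      using flux_strict_mono [of "u2' x" "u1' x"] by (force simp: W_def)
    have "\<kappa>1 * u1' x \<le> \<kappa>1 * u2' x" using slopes \<open>\<kappa>1 > 0\<close> by simp
    also have "\<dots> < \<kappa>2 * u2' x"
      using bvp_solution_slope_pos [OF sol2] assms x by simp
    finally have concave: "\<kappa>1 * u1' x - \<kappa>2 * u2' x < 0" by simp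
    have crit: "W' x = 0"
    proof (rule DERIV_local_min)
      show "DERIV W x :> W' x" using W_deriv x by simp
      show "0 < min x (a - x)" using x by simp
      show "\<forall>y. \<bar>x - y\<bar> < min x (a - x) \<longrightarrow> W x \<le> W y"
      proof (intro allI impI)
        fix y assume "\<bar>x - y\<bar> < min x (a - x)"
        then have "y \<in> {0..a}" unfolding atLeastAtMost_iff by linarith
        then show "W x \<le> W y" by (rule x_min)
      qed
    qed
    obtain y where "0 < y" "y < a" "W y < W x"
      using second_derivative_test_not_min [of 0 x a W W', OF x _ crit W'_deriv concave]
        W_deriv x by auto
    then show False using x_min [of y] by simp
  qed

  have slopes: "u1' r > u2' r" if r: "0 < r" "r < a" for r
    using W_pos [OF r] flux_less_iff [of "u2' r" "u1' r"] r
      bvp_solution_slope_bound [OF sol1] bvp_solution_slope_bound [OF sol2]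
    by (simp add: W_def)

  have "0 \<le> W' 0"
  proof (rule ccontr)
    assume "\<not> 0 \<le> W' 0"
    then obtain d where d: "0 < d" "\<And>h. \<lbrakk>0 < h; h < d\<rbrakk> \<Longrightarrow> W (0 + h) < W 0"
      using DERIV_neg_dec_right [OF W_deriv [of 0]] \<open>a > 0\<close> by auto
    obtain h where "0 < h" "h < min d a"
      using dense [of 0 "min d a"] d(1) \<open>a > 0\<close> by auto
    then show False using d(2) [of h] W_pos [of h] W_ends(1) by simp
  qed
  then have "\<kappa>2 * u2 0 \<le> \<kappa>1 * u1 0" by (simp add: W'_def)
  moreover have "\<kappa>1 * u2 0 < \<kappa>2 * u2 0" using assms by simp
  ultimately have "\<kappa>1 * u2 0 < \<kappa>1 * u1 0" by linarith
  then have centre: "u2 0 < u1 0" using \<open>\<kappa>1 > 0\<close> by simp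

  have heights: "u1 r > u2 r" if r: "0 \<le> r" "r \<le> a" for r
  proof -
    have "u1 0 - u2 0 \<le> u1 r - u2 r"
    proof (rule DERIV_nonneg_imp_increasing_open [OF r(1)])
      show "\<exists>d. DERIV (\<lambda>r. u1 r - u2 r) t :> d \<and> 0 \<le> d" if t: "0 < t" "t < r" for t
        using DERIV_diff [OF bvp_solution_deriv [OF sol1, of t] bvp_solution_deriv [OF sol2, of t]]
          slopes [of t] t r by (intro exI [of _ "u1' t - u2' t"]) auto
      show "continuous_on {0..r} (\<lambda>r. u1 r - u2 r)"
        by (intro continuous_on_diff continuous_on_subset [OF bvp_solution_continuous [OF sol1]]
            continuous_on_subset [OF bvp_solution_continuous [OF sol2]]) (use r in auto)
    qed
    then show ?thesis using centre by simp
  qed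
  from heights slopes show ?thesis by blast
qed

end
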